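(* Let $0<k\le 1$, let $a_1,\dots,a_n$ be points with $|a_j|>1$, and let $w(z)=\prod_{j=1}^n(z-a_j)$. Suppose $r(z)=\frac{p(z)}{w(z)}\in\Re_n(a_1,\dots,a_n)$ has exactly $n$ poles, at $a_1,\dots,a_n$, and all its zeros lie in $\{|z|\le k\}$, with a zero of order $s$ at the origin; that is, $p(z)=c_m z^s\prod_{j=1}^{m-s}(z-b_j)$ with $c_m\ne 0$, $m\le n$, $|b_j|\le k\le 1$ for $j=1,\dots,m-s$, where $m$ is the number of zeros of $r$. Then for all $z$ with $|z|=1$, $$|r'(z)|\ge \frac12\left\{|B'(z)|-n+\frac{2(m+sk)}{1+k}+2\left(\sum_{j=1}^{m-s}\frac{1}{1+|b_j|}-\frac{m-s}{1+k}\right)\right\}|r(z)|.$$ The result is sharp: equality holds at $z=1$ for $r(z)=\frac{z^s(z+k)^{m-s}}{(z-a)^n}$ and $B(z)=\left(\frac{1-az}{z-a}\right)^n$, where $m\le n$ and $k\le 1<a$.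
   Context: For points $a_1,\dots,a_n$ (not necessarily distinct) with $|a_j|>1$ and $w(z)=\prod_{j=1}^n(z-a_j)$, $\Re_n=\Re_n(a_1,\dots,a_n)$ is the set of rational functions $p/w$ where $p$ is a complex polynomial of degree at most $n$. The Blaschke product is $B(z)=\frac{w^*(z)}{w(z)}=\prod_{j=1}^n\frac{1-\overline{a_j}z}{z-a_j}$, where $w^*(z)=z^n\overline{w(1/\overline z)}$. Poles and zeros are counted with multiplicity. "Zero of order $s$ at the origin" means exactly order $s$, so the $b_j$ are the nonzero zeros of $r$. *)

theory Defs
  imports
    "HOL-Complex_Analysis.Complex_Analysis"
    "HOL-Computational_Algebra.Polynomial"
begin

definition wpoly :: "nat \<Rightarrow> (nat \<Rightarrow> complex) \<Rightarrow> complex poly" where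
  "wpoly n a = (\<Prod>j=1..n. [:- a j, 1:])"

text \<open>The class of rational functions \<open>p / w\<close> with \<open>deg p \<le> n\<close>, as total functions on the
  complex plane; at the points \<open>a j\<close> they take the value 0 because of \<open>x / 0 = 0\<close>.\<close>
definition ratfuns :: "nat \<Rightarrow> (nat \<Rightarrow> complex) \<Rightarrow> (complex \<Rightarrow> complex) set" where
  "ratfuns n a = {r. \<exists>p. degree p \<le> n \<and> r = (\<lambda>z. poly p z / poly (wpoly n a) z)}"

definition blaschke :: "nat \<Rightarrow> (nat \<Rightarrow> complex) \<Rightarrow> complex \<Rightarrow> complex" where
  "blaschke n a z = (\<Prod>j=1..n. (1 - cnj (a j) * z) / (z - a j))"

text \<open>\<open>B = w\<^sup>* / w\<close> with \<open>w\<^sup>*(z) = z\<^sup>n cnj (w (1 / cnj z))\<close>. This expression for \<open>w\<^sup>*\<close> has a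
  removable singularity at 0, which is why \<open>B\<close> is defined above by the product.\<close>
lemma blaschke_eq_wstar_div_w:
  assumes "z \<noteq> 0"
  shows "blaschke n a z = z ^ n * cnj (poly (wpoly n a) (1 / cnj z)) / poly (wpoly n a) z"
proof -
  have "z ^ n * cnj (poly (wpoly n a) (1 / cnj z)) = (\<Prod>j=1..n. z * (1 / z - cnj (a j)))"
    by (simp add: wpoly_def poly_prod prod.distrib)
  also have "\<dots> = (\<Prod>j=1..n. 1 - cnj (a j) * z)"
    using assms by (intro prod.cong) (auto simp: field_simps)
  finally show ?thesis
    by (simp add: blaschke_def wpoly_def poly_prod prod_dividef)
qed

text \<open>The poles of \<open>r\<close> are precisely \<open>a 1, \<dots>, a n\<close>, counted with multiplicity
  (\<open>zorder\<close> is negative at poles).\<close>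
definition poles_exactly :: "nat \<Rightarrow> (nat \<Rightarrow> complex) \<Rightarrow> (complex \<Rightarrow> complex) \<Rightarrow> bool" where
  "poles_exactly n a r \<longleftrightarrow>
     {z. is_pole r z} = a ` {1..n} \<and>
     (\<forall>z\<in>a ` {1..n}. zorder r z = - int (card {j\<in>{1..n}. a j = z}))"

text \<open>For \<open>s \<le> m\<close> and \<open>k < cmod (a j)\<close>: \<open>r\<close> has \<open>m\<close> zeros, counted with multiplicity, all
  of them in the disc of radius \<open>k\<close>: a zero of order exactly \<open>s\<close> at the origin and the nonzero zeros \<open>b 1, \<dots>, b (m - s)\<close>.\<close>
definition zeros_in_disc ::
    "real \<Rightarrow> nat \<Rightarrow> (nat \<Rightarrow> complex) \<Rightarrow> nat \<Rightarrow> nat \<Rightarrow> (nat \<Rightarrow> complex) \<Rightarrow> (complex \<Rightarrow> complex) \<Rightarrow> bool"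
  where
  "zeros_in_disc k n a m s b r \<longleftrightarrow>
     (\<forall>j\<in>{1..m - s}. b j \<noteq> 0 \<and> cmod (b j) \<le> k) \<and>
     (\<exists>c p. c \<noteq> 0 \<and> p = smult c (monom 1 s * (\<Prod>j=1..m - s. [:- b j, 1:])) \<and>
            r = (\<lambda>z. poly p z / poly (wpoly n a) z))"

end

theory Submission
  imports Defs
begin

text \<open>On the unit circle the bracket in the claim equals
  \<open>2 Re (z r'(z) / r(z))\<close> up to the estimate \<open>Re (z / (z - b)) \<ge> 1 / (1 + \<bar>b\<bar>)\<close> for \<open>\<bar>b\<bar> \<le> 1\<close>: each
  pole contributes \<open>Re (z / (z - a)) = 1/2 - (\<bar>a\<bar>\<^sup>2 - 1) / (2 \<bar>z - a\<bar>\<^sup>2)\<close>, the last fractions add up to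
  \<open>\<bar>B'(z)\<bar> / 2\<close>, and the terms in \<open>k\<close> cancel to leave \<open>s\<close>. For the extremal function,
  \<open>r'(1) / r(1)\<close> is a positive real and every estimate is an equality.\<close>

section \<open>Logarithmic derivatives of products and quotients\<close>

text \<open>Writing a derivative as \<open>f z * l\<close> makes \<open>l\<close> the logarithmic
  derivative without dividing by \<open>f z\<close>. In this form the product rule adds the
  \<open>l\<close>, the quotient rule subtracts them, and a factored rational function can be
  differentiated factor by factor.\<close>

lemma has_field_derivative_logderiv_mult:
  assumes "(f has_field_derivative f z * l) (at z)" "(g has_field_derivative g z * l') (at z)"
  shows "((\<lambda>x. f x * g x) has_field_derivative (f z * g z) * (l + l')) (at z)"
  using DERIV_mult[OF assms] by (simp add: algebra_simps)

lemma has_field_derivative_logderiv_divide: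
  assumes "(f has_field_derivative f z * l) (at z)" "(g has_field_derivative g z * l') (at z)"
    and "g z \<noteq> 0"
  shows "((\<lambda>x. f x / g x) has_field_derivative (f z / g z) * (l - l')) (at z)"
  using DERIV_cong[OF DERIV_divide[OF assms], of "(f z / g z) * (l - l')"] assms(3)
  by (simp add: field_simps)

lemma has_field_derivative_logderiv_prod:
  assumes "\<And>j. j \<in> A \<Longrightarrow> (f j has_field_derivative f j z * l j) (at z)"
  shows "((\<lambda>x. \<Prod>j\<in>A. f j x) has_field_derivative (\<Prod>j\<in>A. f j z) * (\<Sum>j\<in>A. l j)) (at z)"
  using assms
proof (induction A rule: infinite_finite_induct)
  case (insert i A)
  then show ?case
    using has_field_derivative_logderiv_mult[of "f i" z "l i" "\<lambda>x. \<Prod>j\<in>A. f j x"] by simp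
qed auto

lemma has_field_derivative_factored_ratfun:
  fixes z c :: complex and s :: nat
  assumes "z \<noteq> 0" "\<And>j. j \<in> A \<Longrightarrow> z \<noteq> b j" "\<And>j. j \<in> C \<Longrightarrow> z \<noteq> a j" "finite C"
  defines "r \<equiv> \<lambda>x. c * (x ^ s * (\<Prod>j\<in>A. x - b j)) / (\<Prod>j\<in>C. x - a j)"
  shows "(r has_field_derivative
           r z * (of_nat s / z + (\<Sum>j\<in>A. 1 / (z - b j)) - (\<Sum>j\<in>C. 1 / (z - a j)))) (at z)"
proof -
  have factor: "((\<lambda>x. x - d) has_field_derivative (z - d) * (1 / (z - d))) (at z)"
    if "z \<noteq> d" for d
    using that by (auto intro!: derivative_eq_intros)
  have c: "((\<lambda>x. c) has_field_derivative c * 0) (at z)"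
    by simp
  have pow: "((\<lambda>x. x ^ s) has_field_derivative z ^ s * (of_nat s / z)) (at z)"
  proof -
    \<comment> \<open>For \<open>s = 0\<close> both sides are 0, so the truncated exponent does no
      harm.\<close>
    have "z ^ s * (of_nat s / z) = of_nat s * z ^ (s - Suc 0)"
      using \<open>z \<noteq> 0\<close> by (cases s) auto
    then show ?thesis
      by (auto intro!: derivative_eq_intros)
  qed
  have "(\<Prod>j\<in>C. z - a j) \<noteq> 0"
    using assms by auto
  then show ?thesis
    unfolding r_def
    using has_field_derivative_logderiv_divide[OF
        has_field_derivative_logderiv_mult[OF c
          has_field_derivative_logderiv_mult[OF pow
            has_field_derivative_logderiv_prod[of A "\<lambda>j x. x - b j", OF factor[OF assms(2)]]]]
        has_field_derivative_logderiv_prod[of C "\<lambda>j x. x - a j", OF factor[OF assms(3)]]]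
    by simp
qed

section \<open>The Blaschke product on the unit circle\<close>

text \<open>Since \<open>z * cnj z = 1\<close>, the numerator of a Blaschke factor is a unimodular
  multiple of the conjugate of its denominator. This yields both the modulus 1 of the factor and its
  logarithmic derivative.\<close>

lemma one_minus_cnj_mult_on_circle:
  assumes "cmod z = 1"
  shows "1 - cnj a * z = z * cnj (z - a)"
proof -
  have "z * cnj z = 1"
    using assms by (simp add: complex_norm_square[symmetric])
  then show ?thesis
    by (simp add: algebra_simps)
qed

text \<open>Each factor contributes a nonnegative real \<open>q j\<close> to
  \<open>z * B'(z) / B(z)\<close>. Nothing is lost in taking the modulus of the sum, and
  \<open>B\<close> itself has modulus 1.\<close>

lemma cmod_deriv_blaschke_on_circle:
  assumes a: "\<And>j. j \<in> {1..n} \<Longrightarrow> 1 < cmod (a j)" and z: "cmod z = 1"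
  shows "cmod (deriv (blaschke n a) z) = (\<Sum>j=1..n. ((cmod (a j))\<^sup>2 - 1) / (cmod (z - a j))\<^sup>2)"
proof -
  define q where "q j = ((cmod (a j))\<^sup>2 - 1) / (cmod (z - a j))\<^sup>2" for j
  have ne: "z - a j \<noteq> 0" if "j \<in> {1..n}" for j
    using a[OF that] z by auto
  have "z \<noteq> 0"
    using z by auto
  \<comment> \<open>Used with \<open>d = z - a j\<close> and \<open>e = cnj d\<close>: the conjugate
    from the numerator of the Blaschke factor cancels the one in \<open>d * cnj d\<close>, the
    square of the modulus of \<open>d\<close>.\<close>
  have cancel: "z * e / d * (x / (d * e) / z) = x / (d * d)" if "d \<noteq> 0" "e \<noteq> 0" for d e x
    using \<open>z \<noteq> 0\<close> that by (simp add: field_simps)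
  have "((\<lambda>x. (1 - cnj (a j) * x) / (x - a j)) has_field_derivative
          (1 - cnj (a j) * z) / (z - a j) * (of_real (q j) / z)) (at z)" if j: "j \<in> {1..n}" for j
  proof -
    \<comment> \<open>This is the numerator in the quotient rule; its terms in \<open>z\<close>
      cancel.\<close>
    have "- cnj (a j) * (z - a j) - (1 - cnj (a j) * z) = of_real ((cmod (a j))\<^sup>2 - 1)"
      using complex_norm_square[of "a j"] by (simp add: algebra_simps)
    moreover have "(1 - cnj (a j) * z) / (z - a j) * (of_real (q j) / z)
        = of_real ((cmod (a j))\<^sup>2 - 1) / ((z - a j) * (z - a j))"
      unfolding one_minus_cnj_mult_on_circle[OF z] q_def of_real_divide complex_norm_square
      by (rule cancel) (use ne[OF j] in simp_all)
    ultimately show ?thesis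
      using ne[OF j] by (auto intro!: derivative_eq_intros)
  qed
  then have "(blaschke n a has_field_derivative
      blaschke n a z * (\<Sum>j=1..n. of_real (q j) / z)) (at z)"
    using has_field_derivative_logderiv_prod
      [of "{1..n}" "\<lambda>j x. (1 - cnj (a j) * x) / (x - a j)" z "\<lambda>j. of_real (q j) / z"]
    unfolding blaschke_def[abs_def] by blast
  then have "cmod (deriv (blaschke n a) z)
      = cmod (blaschke n a z) * cmod (of_real (\<Sum>j=1..n. q j) / z)"
    by (simp add: DERIV_imp_deriv norm_mult sum_divide_distrib)
  moreover have "cmod (blaschke n a z) = 1"
  proof -
    have "cmod ((1 - cnj (a j) * z) / (z - a j)) = 1" if "j \<in> {1..n}" for j
      using ne[OF that] z unfolding one_minus_cnj_mult_on_circle[OF z] norm_divide norm_mult complex_mod_cnj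
      by simp
    then show ?thesis
      unfolding blaschke_def prod_norm[symmetric] by (intro prod.neutral) blast
  qed
  moreover have "(\<Sum>j=1..n. q j) \<ge> 0"
  proof (intro sum_nonneg)
    fix j assume "j \<in> {1..n}"
    then show "0 \<le> q j"
      using a[of j] by (simp add: q_def)
  qed
  ultimately show ?thesis
    using z unfolding norm_divide norm_of_real q_def by (simp add: abs_of_nonneg)
qed

section \<open>Contributions of single zeros and poles on the circle\<close>

text \<open>Multiplying numerator and denominator by \<open>cnj (z - a)\<close> leaves
  \<open>1 - Re (z * cnj a)\<close> on top, which the expansion of the squared distance expresses
  through \<open>cmod (z - a)\<close> and \<open>cmod a\<close>. The point may lie on either side of
  the circle, so the identity serves poles and zeros alike.\<close>

lemma Re_divide_diff_on_circle:
  assumes "cmod z = 1" "z \<noteq> a"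
  shows "Re (z / (z - a)) = 1/2 - ((cmod a)\<^sup>2 - 1) / (cmod (z - a))\<^sup>2 / 2"
proof -
  have z: "(Re z)\<^sup>2 + (Im z)\<^sup>2 = 1"
    using assms(1) cmod_power2[of z] by simp
  then have *: "(cmod (z - a))\<^sup>2 = 1 - 2 * Re (z * cnj a) + (cmod a)\<^sup>2"
    unfolding cmod_power2 by (simp add: power2_eq_square algebra_simps)
  have "Re (z / (z - a)) = (1 - Re (z * cnj a)) / (cmod (z - a))\<^sup>2"
    using z by (simp add: Re_divide' power2_eq_square algebra_simps)
  also have "1 - Re (z * cnj a) = ((cmod (z - a))\<^sup>2 - ((cmod a)\<^sup>2 - 1)) / 2"
    using * by simp
  also have "\<dots> / (cmod (z - a))\<^sup>2 = 1/2 - ((cmod a)\<^sup>2 - 1) / (cmod (z - a))\<^sup>2 / 2"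
    using assms(2) by (simp add: diff_divide_distrib)
  finally show ?thesis .
qed

text \<open>In the preceding identity the numerator \<open>1 - (cmod b)\<^sup>2\<close> is
  nonnegative, so the worst case is the largest distance, \<open>cmod (z - b) = 1 + cmod b\<close>.
  It is attained when \<open>b\<close> is a nonpositive multiple of \<open>z\<close>, as for
  \<open>z = 1\<close> and \<open>b = -k\<close>.\<close>

lemma Re_divide_diff_ge:
  assumes "cmod z = 1" "cmod b \<le> 1" "z \<noteq> b"
  shows "Re (z / (z - b)) \<ge> 1 / (1 + cmod b)"
proof -
  have "(cmod (z - b))\<^sup>2 \<le> (1 + cmod b)\<^sup>2"
    using norm_triangle_ineq4[of z b] assms(1) by (intro power_mono) auto
  moreover have "0 < (cmod (z - b))\<^sup>2"
    using assms by simp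
  moreover have "0 < (1 + cmod b)\<^sup>2"
    using norm_ge_zero[of b] by (intro zero_less_power) linarith
  ultimately have "(1 - (cmod b)\<^sup>2) / (1 + cmod b)\<^sup>2 \<le> (1 - (cmod b)\<^sup>2) / (cmod (z - b))\<^sup>2"
    using assms(2) by (intro divide_left_mono) (auto simp: power_le_one)
  \<comment> \<open>One factor \<open>1 + cmod b\<close> cancels; half of this value plus 1/2 is the
    claimed bound.\<close>
  moreover have "(1 - (cmod b)\<^sup>2) / (1 + cmod b)\<^sup>2 = 2 / (1 + cmod b) - 1"
  proof -
    have "1 + cmod b \<noteq> 0"
      using norm_ge_zero[of b] by linarith
    then show ?thesis
      by (simp add: divide_simps) (simp add: power2_eq_square algebra_simps)
  qed
  moreover have "((cmod b)\<^sup>2 - 1) / (cmod (z - b))\<^sup>2 = - ((1 - (cmod b)\<^sup>2) / (cmod (z - b))\<^sup>2)"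
    by (simp add: minus_divide_left)
  ultimately show ?thesis
    unfolding Re_divide_diff_on_circle[OF assms(1,3)] by argo
qed

section \<open>The lower bound for the derivative\<close>

text \<open>The split \<open>m + s * k = (m - s) + s * (1 + k)\<close> shows that the terms in
  \<open>k\<close> cancel.\<close>

lemma bound_cancel:
  fixes k :: real
  assumes "0 < k" "s \<le> m"
  shows "2 * (real m + real s * k) / (1 + k) + 2 * (S - real (m - s) / (1 + k)) = 2 * real s + 2 * S"
proof -
  have "(real m + real s * k) / (1 + k) = real (m - s) / (1 + k) + real s"
    using assms by (simp add: of_nat_diff field_simps)
  then show ?thesis
    unfolding times_divide_eq_right[symmetric] by (simp add: algebra_simps)
qed

lemma zeros_in_disc_factored:
  assumes "zeros_in_disc k n a m s b r"
  obtains c where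
    "r = (\<lambda>x. c * (x ^ s * (\<Prod>j=1..m - s. x - b j)) / (\<Prod>j=1..n. x - a j))"
    "\<And>j. j \<in> {1..m - s} \<Longrightarrow> cmod (b j) \<le> k"
proof -
  obtain c p where "p = smult c (monom 1 s * (\<Prod>j=1..m - s. [:- b j, 1:]))"
    and "r = (\<lambda>z. poly p z / poly (wpoly n a) z)"
    and b: "\<And>j. j \<in> {1..m - s} \<Longrightarrow> cmod (b j) \<le> k"
    using assms unfolding zeros_in_disc_def by blast
  then have "r = (\<lambda>x. c * (x ^ s * (\<Prod>j=1..m - s. x - b j)) / (\<Prod>j=1..n. x - a j))"
    by (simp add: wpoly_def poly_prod poly_monom algebra_simps)
  with b show ?thesis
    using that by blast
qed

text \<open>The real part of \<open>z * r'(z) / r(z)\<close> is \<open>s\<close> plus the zero terms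
  minus the pole terms. The zero terms are estimated from below, while the pole terms are evaluated
  exactly and produce half of \<open>cmod (deriv (blaschke n a) z) - n\<close>. The radius
  \<open>k\<close> enters only through \<open>cmod (b j) \<le> k \<le> 1\<close>.\<close>

lemma cmod_deriv_lower_bound:
  assumes a: "\<And>j. j \<in> {1..n} \<Longrightarrow> 1 < cmod (a j)"
    and zeros: "zeros_in_disc k n a m s b r" and "k \<le> 1" and z: "cmod z = 1"
  shows "cmod (deriv r z) \<ge>
    1/2 * (cmod (deriv (blaschke n a) z) - real n
           + (2 * real s + 2 * (\<Sum>j=1..m - s. 1 / (1 + cmod (b j))))) * cmod (r z)"
proof (cases "r z = 0")
  case False
  obtain c where r: "r = (\<lambda>x. c * (x ^ s * (\<Prod>j=1..m - s. x - b j)) / (\<Prod>j=1..n. x - a j))"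
    and b: "\<And>j. j \<in> {1..m - s} \<Longrightarrow> cmod (b j) \<le> k"
    using zeros_in_disc_factored[OF zeros] by blast
  have "z \<noteq> 0"
    using z by auto
  have za: "z \<noteq> a j" if "j \<in> {1..n}" for j
    using a[OF that] z by auto
  \<comment> \<open>A zero of \<open>r\<close> may lie on the circle when \<open>k = 1\<close>; the
    case \<open>r z = 0\<close>, where the right-hand side vanishes, has been split off.\<close>
  have zb: "z \<noteq> b j" if "j \<in> {1..m - s}" for j
    using False that unfolding r by auto
  define l where "l = of_nat s / z + (\<Sum>j=1..m - s. 1 / (z - b j)) - (\<Sum>j=1..n. 1 / (z - a j))"
  have "deriv r z = r z * l"
    unfolding r l_def
    by (intro DERIV_imp_deriv has_field_derivative_factored_ratfun) (use \<open>z \<noteq> 0\<close> za zb in auto)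
  \<comment> \<open>The factor \<open>z\<close> has modulus 1 and turns each
    \<open>1 / (z - b j)\<close> into the quotient whose real part is controlled.\<close>
  then have deriv: "cmod (deriv r z) = cmod (z * l) * cmod (r z)"
    using z by (simp add: norm_mult)
  have "z * l = of_nat s + (\<Sum>j=1..m - s. z / (z - b j)) - (\<Sum>j=1..n. z / (z - a j))"
    using \<open>z \<noteq> 0\<close> by (simp add: l_def algebra_simps sum_distrib_left)
  then have "Re (z * l) = real s + (\<Sum>j=1..m - s. Re (z / (z - b j))) - (\<Sum>j=1..n. Re (z / (z - a j)))"
    by simp
  moreover have "(\<Sum>j=1..m - s. Re (z / (z - b j))) \<ge> (\<Sum>j=1..m - s. 1 / (1 + cmod (b j)))"
    using b zb z \<open>k \<le> 1\<close> by (intro sum_mono Re_divide_diff_ge) fastforce+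
  moreover have "(\<Sum>j=1..n. Re (z / (z - a j))) = real n / 2 - cmod (deriv (blaschke n a) z) / 2"
  proof -
    have "(\<Sum>j=1..n. Re (z / (z - a j)))
        = (\<Sum>j=1..n. 1/2 - ((cmod (a j))\<^sup>2 - 1) / (cmod (z - a j))\<^sup>2 / 2)"
      using za z by (intro sum.cong Re_divide_diff_on_circle) auto
    then show ?thesis
      using cmod_deriv_blaschke_on_circle[of n a z] a z by (simp add: sum_subtractf sum_divide_distrib)
  qed
  moreover have "Re (z * l) \<le> cmod (z * l)"
    by (rule complex_Re_le_cmod)
  ultimately have "1/2 * (cmod (deriv (blaschke n a) z) - real n
      + (2 * real s + 2 * (\<Sum>j=1..m - s. 1 / (1 + cmod (b j))))) \<le> cmod (z * l)"
    by argo
  then show ?thesis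
    unfolding deriv by (rule mult_right_mono) simp
qed simp

section \<open>The extremal function\<close>

text \<open>As \<open>g\<close> does not vanish at \<open>\<alpha>\<close>, no factor of the
  denominator cancels and the order is exactly \<open>-n\<close>. For \<open>n = 0\<close> the
  function is entire and the list of poles is empty.\<close>

lemma poles_exactly_single_point:
  assumes hol: "g holomorphic_on UNIV" and "g \<alpha> \<noteq> 0"
  shows "poles_exactly n (\<lambda>_. \<alpha>) (\<lambda>z. g z / (z - \<alpha>) ^ n)"
proof -
  define r where "r = (\<lambda>z. g z / (z - \<alpha>) ^ n)"
  have "\<not> is_pole r z" if "z \<noteq> \<alpha> \<or> n = 0" for z
  proof -
    have "isCont g z"
      using hol holomorphic_on_imp_continuous_on[OF hol] by (simp add: continuous_on_eq_continuous_at)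
    then have "isCont r z"
      unfolding r_def using that by (auto intro!: continuous_intros)
    then show ?thesis
      using not_tendsto_and_filterlim_at_infinity[OF at_neq_bot] unfolding isCont_def is_pole_def by blast
  qed
  moreover have "is_pole r \<alpha>" "zorder r \<alpha> = - int n" if "n \<noteq> 0"
  proof -
    show "is_pole r \<alpha>"
      unfolding r_def by (rule is_pole_basic[OF hol]) (use that assms in auto)
    show "zorder r \<alpha> = - int n"
      by (rule zorder_eqI[where S = UNIV and g = g])
        (use assms in \<open>auto simp: r_def power_int_minus field_simps\<close>)
  qed
  \<comment> \<open>The simplifier brings the index set in the multiplicity count to the form on the
    left when all \<open>a j\<close> coincide.\<close>
  moreover have "{j. Suc 0 \<le> j \<and> j \<le> n} = {1..n}"
    by auto
  ultimately show ?thesis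
    unfolding poles_exactly_def r_def[symmetric] by (cases "n = 0") (auto simp: image_constant_conv)
qed

lemma extremal_in_ratfuns:
  assumes "s \<le> m" "m \<le> n"
  shows "(\<lambda>z. z ^ s * (z + \<kappa>) ^ (m - s) / (z - \<alpha>) ^ n) \<in> ratfuns n (\<lambda>_. \<alpha>)"
proof -
  have "degree (monom 1 s * [:\<kappa>, 1:] ^ (m - s)) \<le> degree (monom (1::complex) s) + degree ([:\<kappa>, 1:] ^ (m - s))"
    by (rule degree_mult_le)
  also have "\<dots> = m"
    using assms by (simp add: degree_monom_eq degree_linear_power)
  finally show ?thesis
    unfolding ratfuns_def using assms
    by (auto intro!: exI[of _ "monom 1 s * [:\<kappa>, 1:] ^ (m - s)"]
        simp: wpoly_def poly_monom poly_power algebra_simps)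
qed

lemma extremal_zeros_in_disc:
  assumes "0 < k"
  shows "zeros_in_disc k n (\<lambda>_. \<alpha>) m s (\<lambda>_. - of_real k)
    (\<lambda>z. z ^ s * (z + of_real k) ^ (m - s) / (z - \<alpha>) ^ n)"
  unfolding zeros_in_disc_def using assms
  by (auto intro!: exI[of _ "1::complex"] simp: wpoly_def poly_monom poly_power algebra_simps)

text \<open>At \<open>z = 1\<close> the logarithmic derivative is a nonnegative real, so its modulus
  equals its real part, and every nonzero zero is \<open>-k\<close>, opposite to 1. Both sides can
  then be computed explicitly.\<close>

lemma extremal_cmod_deriv:
  fixes k \<alpha> :: real and m n s :: nat
  assumes "0 < k" "1 < \<alpha>"
  defines "r \<equiv> \<lambda>z :: complex. z ^ s * (z + of_real k) ^ (m - s) / (z - of_real \<alpha>) ^ n"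
  shows "cmod (deriv r 1) =
    1/2 * (cmod (deriv (blaschke n (\<lambda>_. of_real \<alpha>)) 1) - real n
           + (2 * real s + 2 * (real (m - s) / (1 + k)))) * cmod (r 1)"
proof -
  have ne: "1 \<noteq> - complex_of_real k" "1 \<noteq> complex_of_real \<alpha>"
    using assms by (auto simp: complex_eq_iff)
  \<comment> \<open>The value of \<open>r'(1) / r(1)\<close>; the pole term
    \<open>- n / (1 - \<alpha>)\<close> becomes positive because
    \<open>\<alpha> > 1\<close>.\<close>
  define l where "l = real s + real (m - s) / (1 + k) + real n / (\<alpha> - 1)"
  have "deriv r 1 = r 1 * (of_nat s + of_nat (m - s) * (1 / (1 + of_real k)) - of_nat n * (1 / (1 - of_real \<alpha>)))"
    using has_field_derivative_factored_ratfun[where z = 1 and A = "{1..m - s}" and C = "{1..n}"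
        and b = "\<lambda>_. - of_real k" and a = "\<lambda>_. of_real \<alpha>" and c = 1 and s = s] ne
    unfolding r_def by (intro DERIV_imp_deriv) auto
  also have "\<dots> = r 1 * of_real l"
  proof -
    have "complex_of_real \<alpha> - 1 \<noteq> 0" "1 - complex_of_real \<alpha> \<noteq> 0"
      using ne by auto
    then show ?thesis
      by (simp add: l_def field_simps)
  qed
  finally have "cmod (deriv r 1) = cmod (r 1) * \<bar>l\<bar>"
    by (simp only: norm_mult norm_of_real)
  moreover have "l \<ge> 0"
    using assms(1,2) by (simp add: l_def)
  moreover have "cmod (deriv (blaschke n (\<lambda>_. of_real \<alpha>)) 1) = real n + 2 * (real n / (\<alpha> - 1))"
  proof -
    have "cmod (1 - of_real \<alpha>) = \<alpha> - 1"
      using assms norm_of_real[of "1 - \<alpha>", where 'a = complex] by simp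
    \<comment> \<open>The quotient reduces to \<open>(\<alpha> + 1) / (\<alpha> - 1)\<close>;
      splitting off 1 isolates the term that occurs in \<open>l\<close>.\<close>
    moreover have "(\<alpha>\<^sup>2 - 1) / (\<alpha> - 1)\<^sup>2 = 1 + 2 / (\<alpha> - 1)"
      using assms by (simp add: divide_simps) (simp add: power2_eq_square algebra_simps)
    moreover have "cmod (deriv (blaschke n (\<lambda>_. of_real \<alpha>)) 1)
        = real n * ((\<alpha>\<^sup>2 - 1) / (cmod (1 - of_real \<alpha>))\<^sup>2)"
      using assms(2) cmod_deriv_blaschke_on_circle[of n "\<lambda>_. of_real \<alpha>" 1] by simp
    ultimately show ?thesis
      by (simp only:) (simp add: distrib_left)
  qed
  ultimately show ?thesis
    by (simp add: l_def mult.commute)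
qed

theorem theorem3p1:
  fixes k :: real and n m s :: nat
  assumes "0 < k" and "k \<le> 1" and "s \<le> m" and "m \<le> n"
  shows "(\<forall>(a :: nat \<Rightarrow> complex) (b :: nat \<Rightarrow> complex) (r :: complex \<Rightarrow> complex).
           (\<forall>j\<in>{1..n}. 1 < cmod (a j)) \<longrightarrow>
           r \<in> ratfuns n a \<longrightarrow> poles_exactly n a r \<longrightarrow> zeros_in_disc k n a m s b r \<longrightarrow>
           (\<forall>z. cmod z = 1 \<longrightarrow>
              cmod (deriv r z) \<ge>
                1/2 * (cmod (deriv (blaschke n a) z) - real n
                       + 2 * (real m + real s * k) / (1 + k)
                       + 2 * ((\<Sum>j=1..m - s. 1 / (1 + cmod (b j))) - real (m - s) / (1 + k)))
                    * cmod (r z))) \<and>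
         (\<forall>\<alpha> :: real. 1 < \<alpha> \<longrightarrow>
           (let a = (\<lambda>_. of_real \<alpha>) :: nat \<Rightarrow> complex;
                b = (\<lambda>_. - of_real k) :: nat \<Rightarrow> complex;
                r = (\<lambda>z :: complex. z ^ s * (z + of_real k) ^ (m - s) / (z - of_real \<alpha>) ^ n);
                B = (\<lambda>z :: complex. ((1 - of_real \<alpha> * z) / (z - of_real \<alpha>)) ^ n)
            in r \<in> ratfuns n a \<and> poles_exactly n a r \<and> zeros_in_disc k n a m s b r \<and>
               B = blaschke n a \<and>
               cmod (deriv r 1) =
                 1/2 * (cmod (deriv B 1) - real n
                        + 2 * (real m + real s * k) / (1 + k)
                        + 2 * ((\<Sum>j=1..m - s. 1 / (1 + cmod (b j))) - real (m - s) / (1 + k)))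
                     * cmod (r 1)))"
proof (intro conjI allI impI)
  fix a b :: "nat \<Rightarrow> complex" and r :: "complex \<Rightarrow> complex" and z
  assume "\<forall>j\<in>{1..n}. 1 < cmod (a j)" "zeros_in_disc k n a m s b r" "cmod z = 1"
  then show "1/2 * (cmod (deriv (blaschke n a) z) - real n
                 + 2 * (real m + real s * k) / (1 + k)
                 + 2 * ((\<Sum>j=1..m - s. 1 / (1 + cmod (b j))) - real (m - s) / (1 + k)))
               * cmod (r z) \<le> cmod (deriv r z)"
    \<comment> \<open>Reassociating the sum brings the two terms in \<open>k\<close> together, so
      that \<open>bound_cancel\<close> rewrites them.\<close>
    using cmod_deriv_lower_bound[of n a k m s b r z] assms(2)
    unfolding add.assoc bound_cancel[OF assms(1,3)] by simp
next
  fix \<alpha> :: real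
  assume \<alpha>: "1 < \<alpha>"
  define g where "g z = z ^ s * (z + of_real k) ^ (m - s)" for z :: complex
  have "poles_exactly n (\<lambda>_. of_real \<alpha>) (\<lambda>z. g z / (z - of_real \<alpha>) ^ n)"
  proof (rule poles_exactly_single_point)
    show "g holomorphic_on UNIV"
      unfolding g_def by (intro holomorphic_intros)
    \<comment> \<open>The bases of the powers in \<open>g\<close> at \<open>\<alpha>\<close>;
      keeping the sum under a single \<open>of_real\<close> lets positivity over the reals decide
      that it is nonzero.\<close>
    have "complex_of_real (\<alpha> + k) \<noteq> 0" "complex_of_real \<alpha> \<noteq> 0"
      using \<alpha> assms(1) by (simp_all del: of_real_add)
    then show "g (of_real \<alpha>) \<noteq> 0"
      by (simp add: g_def)
  qed
  moreover have B: "(\<lambda>z. ((1 - of_real \<alpha> * z) / (z - of_real \<alpha>)) ^ n) = blaschke n (\<lambda>_. of_real \<alpha>)"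
    by (simp add: blaschke_def fun_eq_iff)
  ultimately show "let a = (\<lambda>_. of_real \<alpha>) :: nat \<Rightarrow> complex;
                b = (\<lambda>_. - of_real k) :: nat \<Rightarrow> complex;
                r = (\<lambda>z :: complex. z ^ s * (z + of_real k) ^ (m - s) / (z - of_real \<alpha>) ^ n);
                B = (\<lambda>z :: complex. ((1 - of_real \<alpha> * z) / (z - of_real \<alpha>)) ^ n)
            in r \<in> ratfuns n a \<and> poles_exactly n a r \<and> zeros_in_disc k n a m s b r \<and>
               B = blaschke n a \<and>
               cmod (deriv r 1) =
                 1/2 * (cmod (deriv B 1) - real n
                        + 2 * (real m + real s * k) / (1 + k)
                        + 2 * ((\<Sum>j=1..m - s. 1 / (1 + cmod (b j))) - real (m - s) / (1 + k)))
                     * cmod (r 1)"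
    unfolding Let_def B add.assoc bound_cancel[OF assms(1,3)] g_def
    using extremal_in_ratfuns[OF assms(3,4)] extremal_zeros_in_disc[OF assms(1)]
      extremal_cmod_deriv[OF assms(1) \<alpha>] assms(1)
    by simp
qed

end
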